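(* Let $L>0$, and let $M\ge 2$, $n\ge 1$, $d\ge 1$ be integers. Let $\mathcal{F}$ be the class of all probability densities $f$ with respect to the Lebesgue measure on $\mathbf{R}^d$ such that $\|f\|_\infty\le L$. Let $x\ge 0$ satisfy $$\frac{\log(M)+x}{n}<3 .$$ Then there exist $f_1,\ldots,f_M\in L^2(\mathbf{R}^d)$ with $\|f_j\|_\infty\le L$ for all $j=1,\ldots,M$ such that $$\inf_{\hat S_n}\ \sup_{f\in\mathcal{F}}\ \mathbb{P}_f\left(\|\hat S_n-f\|^2-\inf_{j=1,\ldots,M}\|f_j-f\|^2\ \ge\ \frac{L}{\sqrt3}\sqrt{\frac{x+\log M}{n}}\right)\ \ge\ \frac1{24}\exp(-x),$$ where $\mathbb{P}_f$ denotes the probability with respect to $n$ i.i.d. observations $X_1,\ldots,X_n$ with density $f$, and the infimum is taken over all selectors $\hat S_n$.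
   Context: $\|\cdot\|$ is the $L^2$ norm with respect to the Lebesgue measure on $\mathbf{R}^d$. Given functions $f_1,\ldots,f_M$, a selector is an estimator of the form $\hat S_n=f_{\hat J}$, where $\hat J$ is a random index with values in $\{1,\ldots,M\}$ that is measurable with respect to the observations $X_1,\ldots,X_n$. *)

theory Defs
  imports "HOL-Probability.Probability" "HOL-Probability.Essential_Supremum"
begin

definition square_integrable_functions :: "(real ^ 'd \<Rightarrow> real) set" where
  "square_integrable_functions =
     {f \<in> borel_measurable lborel. integrable lborel (\<lambda>x. (f x)\<^sup>2)}"

text \<open>Meaningful only on square-integrable functions: the Bochner integral is \<open>0\<close> for
  non-integrable integrands.\<close>

definition L2_norm :: "(real ^ 'd \<Rightarrow> real) \<Rightarrow> real" where
  "L2_norm f = sqrt (\<integral>x. (f x)\<^sup>2 \<partial>lborel)"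

definition Linf_norm :: "(real ^ 'd \<Rightarrow> real) \<Rightarrow> ereal" where
  "Linf_norm f = esssup lborel (\<lambda>x. ereal \<bar>f x\<bar>)"

definition probability_densities :: "(real ^ 'd \<Rightarrow> real) set" where
  "probability_densities =
     {f \<in> borel_measurable lborel. (\<forall>x. 0 \<le> f x) \<and> (\<integral>\<^sup>+x. ennreal (f x) \<partial>lborel) = 1}"

definition bounded_densities :: "real \<Rightarrow> (real ^ 'd \<Rightarrow> real) set" where
  "bounded_densities L = {f \<in> probability_densities. Linf_norm f \<le> ereal L}"

text \<open>The joint law of \<open>X\<^sub>1, \<dots>, X\<^sub>n\<close>, i.i.d. with density \<open>f\<close>; the observations are the
  coordinates of a sample point \<open>X\<close>.\<close>

definition sample_law :: "nat \<Rightarrow> (real ^ 'd \<Rightarrow> real) \<Rightarrow> (nat \<Rightarrow> real ^ 'd) measure" where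
  "sample_law n f = (\<Pi>\<^sub>M i\<in>{1..n}. density lborel (\<lambda>x. ennreal (f x)))"

text \<open>An index that is measurable with respect to the observations is a measurable function of
  the sample point, so that no external randomization is available.  A selector maps a sample
  point to a function on \<open>\<real>\<^sup>d\<close>.\<close>

definition selectors ::
    "nat \<Rightarrow> nat \<Rightarrow> (nat \<Rightarrow> real ^ 'd \<Rightarrow> real) \<Rightarrow> ((nat \<Rightarrow> real ^ 'd) \<Rightarrow> real ^ 'd \<Rightarrow> real) set" where
  "selectors n M fs =
     {\<lambda>X. fs (J X) | J. J \<in> (\<Pi>\<^sub>M i\<in>{1..n}. borel) \<rightarrow>\<^sub>M count_space {1..M}}"

definition excess_risk ::
    "nat \<Rightarrow> (nat \<Rightarrow> real ^ 'd \<Rightarrow> real) \<Rightarrow> (real ^ 'd \<Rightarrow> real) \<Rightarrow> (real ^ 'd \<Rightarrow> real) \<Rightarrow> real" where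
  "excess_risk M fs f g =
     (L2_norm (\<lambda>x. g x - f x))\<^sup>2 - (INF j\<in>{1..M}. (L2_norm (\<lambda>x. fs j x - f x))\<^sup>2)"

end

theory Submission
  imports Defs
begin

text \<open>Let \<open>B\<close> be a slab of volume \<open>2 / L\<close>, let \<open>e\<^sub>1, \<dots>, e\<^sub>M\<close> be Rademacher functions on \<open>B\<close>, and put
  \<open>f\<^sub>j = (L / 2) 1\<^sub>B (1 + e\<^sub>j)\<close>.  If the true density is \<open>(L / 2) 1\<^sub>B (1 + \<gamma> e\<^sub>j)\<close> with
  \<open>\<gamma>\<^sup>2 = (x + ln M) / (3 n) < 1\<close>, then by orthogonality every index other than \<open>j\<close> has excess risk
  at least \<open>L \<gamma>\<close>, the threshold of the theorem, so it suffices to bound the error of identifying \<open>j\<close>.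
  Let \<open>g\<^sub>j\<close> be the likelihood ratio of the \<open>j\<close>-th hypothesis against the uniform law on \<open>B\<close>.
  For \<open>x \<le> ln M\<close>, the sum of the success probabilities is at most \<open>sqrt (M C)\<close>, where
  \<open>C = (1 + \<gamma>\<^sup>2)\<^sup>n\<close> is the second moment of \<open>g\<^sub>j\<close>.  For \<open>x > ln M\<close>, two of the hypotheses suffice:
  their Hellinger affinity is \<open>((1 + sqrt (1 - \<gamma>\<^sup>2)) / 2)\<^sup>n \<ge> 2 powr (- n \<gamma>\<^sup>2)\<close>, which does not
  degenerate as \<open>\<gamma>\<close> tends to \<open>1\<close>, unlike their Kullback divergence.\<close>

section \<open>Testing bounds\<close>

text \<open>Bound \<open>g j w\<close> on the event \<open>J w = j\<close> by
  \<open>(g j w)\<^sup>2 / (2 * r) + r / 2\<close> and sum over \<open>j\<close>. The events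
  partition the space, so the terms \<open>r / 2\<close> contribute \<open>r / 2\<close> in total,
  while the squares contribute at most \<open>card I * C / (2 * r)\<close>.\<close>

lemma (in prob_space) sum_success_le:
  fixes g :: "'i \<Rightarrow> 'a \<Rightarrow> real" and C :: real
  assumes fin: "finite I" and ne: "I \<noteq> {}" and C: "C > 0"
    and int: "\<And>j. j \<in> I \<Longrightarrow> integrable M (g j)"
    and int2: "\<And>j. j \<in> I \<Longrightarrow> integrable M (\<lambda>w. (g j w)\<^sup>2)"
    and le: "\<And>j. j \<in> I \<Longrightarrow> (\<integral>w. (g j w)\<^sup>2 \<partial>M) \<le> C"
    and J: "J \<in> M \<rightarrow>\<^sub>M count_space I"
  shows "(\<Sum>j\<in>I. \<integral>w. g j w * indicator {w. J w = j} w \<partial>M) \<le> sqrt (card I * C)"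
proof -
  \<comment> \<open>This value minimises \<open>card I * C / (2 * r) + r / 2\<close>, and the
    minimum is \<open>r\<close> itself.\<close>
  define r where "r = sqrt (card I * C)"
  have r: "r > 0" "r * r = card I * C"
    using fin ne C by (auto simp: r_def card_gt_0_iff)
  have ev: "{w \<in> space M. J w = j} \<in> events" if "j \<in> I" for j
    using measurable_sets[OF J, of "{j}"] that by (simp add: vimage_def Int_def conj_commute)
  have part: "(\<Sum>j\<in>I. prob {w \<in> space M. J w = j}) = 1"
  proof -
    have "(\<Sum>j\<in>I. prob {w \<in> space M. J w = j}) = prob (\<Union>j\<in>I. {w \<in> space M. J w = j})"
      using fin ev by (intro finite_measure_finite_Union[symmetric]) (auto simp: disjoint_family_on_def)
    also have "(\<Union>j\<in>I. {w \<in> space M. J w = j}) = space M"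
      using measurable_space[OF J] by auto
    finally show ?thesis by (simp add: prob_space)
  qed
  have single: "(\<integral>w. g j w * indicator {w. J w = j} w \<partial>M)
      \<le> C / (2 * r) + r / 2 * prob {w \<in> space M. J w = j}" if j: "j \<in> I" for j
  proof -
    let ?A = "{w \<in> space M. J w = j}"
    have "(\<integral>w. g j w * indicator {w. J w = j} w \<partial>M) = (\<integral>w. g j w * indicator ?A w \<partial>M)"
      by (intro Bochner_Integration.integral_cong) (auto simp: indicator_def)
    also have "\<dots> \<le> (\<integral>w. (g j w)\<^sup>2 / (2 * r) + r / 2 * indicator ?A w \<partial>M)"
    proof (intro integral_mono)
      show "integrable M (\<lambda>w. g j w * indicator ?A w)"
        using integrable_mult_indicator[OF ev[OF j] int[OF j]] by (simp add: mult.commute)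
      show "integrable M (\<lambda>w. (g j w)\<^sup>2 / (2 * r) + r / 2 * indicator ?A w)"
        using int2[OF j] ev[OF j] by (auto simp: emeasure_eq_measure)
      fix w
      have "0 \<le> (g j w - r)\<^sup>2" by simp
      hence "g j w \<le> (g j w)\<^sup>2 / (2 * r) + r / 2"
        using r(1) by (simp add: field_simps power2_eq_square)
      moreover have "0 \<le> (g j w)\<^sup>2 / (2 * r)" using r by simp
      ultimately show "g j w * indicator ?A w \<le> (g j w)\<^sup>2 / (2 * r) + r / 2 * indicator ?A w"
        by (auto simp: indicator_def)
    qed
    also have "\<dots> = (\<integral>w. (g j w)\<^sup>2 \<partial>M) / (2 * r) + r / 2 * prob ?A"
      using int2[OF j] ev[OF j] by (subst Bochner_Integration.integral_add) (auto simp: emeasure_eq_measure)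
    also have "\<dots> \<le> C / (2 * r) + r / 2 * prob ?A"
      using le[OF j] r by (intro add_right_mono divide_right_mono) auto
    finally show ?thesis .
  qed
  have "(\<Sum>j\<in>I. \<integral>w. g j w * indicator {w. J w = j} w \<partial>M)
      \<le> (\<Sum>j\<in>I. C / (2 * r) + r / 2 * prob {w \<in> space M. J w = j})"
    by (intro sum_mono single)
  also have "\<dots> = card I * C / (2 * r) + r / 2"
    unfolding sum.distrib sum_distrib_left[symmetric] part by simp
  also have "\<dots> = r"
    using r by (simp add: field_simps flip: r(2))
  finally show ?thesis by (simp add: r_def)
qed

text \<open>Le Cam's two-point bound in terms of the Hellinger affinity, the integral of
  \<open>s\<close>. By Cauchy-Schwarz its square is at most the sum of the two errors times the
  integral of \<open>g + h\<close>, which is 2. \<open>A\<close> and \<open>B\<close> stand for the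
  error events of a test; they cover the space because no answer is right under both
  hypotheses.\<close>

lemma two_point_error_ge:
  fixes g h s :: "'a \<Rightarrow> real"
  assumes int: "integrable M g" "integrable M h" "integrable M s"
    and one: "(\<integral>w. g w \<partial>M) = 1" "(\<integral>w. h w \<partial>M) = 1"
    and nonneg: "\<And>w. w \<in> space M \<Longrightarrow> 0 \<le> g w" "\<And>w. w \<in> space M \<Longrightarrow> 0 \<le> h w"
    and s: "\<And>w. w \<in> space M \<Longrightarrow> (s w)\<^sup>2 = g w * h w"
    and pos: "(\<integral>w. s w \<partial>M) > 0"
    and A: "A \<in> sets M" and B: "B \<in> sets M" and AB: "space M \<subseteq> A \<union> B"
  shows "(\<integral>w. s w \<partial>M)\<^sup>2 / 2 \<le> (\<integral>w. g w * indicator A w \<partial>M) + (\<integral>w. h w * indicator B w \<partial>M)"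
proof -
  define r where "r = (\<integral>w. s w \<partial>M)"
  have r: "r > 0" using pos by (simp add: r_def)
  have iA: "integrable M (\<lambda>w. g w * indicator A w)" "integrable M (\<lambda>w. h w * indicator B w)"
    using integrable_mult_indicator[OF A int(1)] integrable_mult_indicator[OF B int(2)]
    by (simp_all add: mult.commute)
  \<comment> \<open>Pointwise form of Cauchy-Schwarz. The weights are chosen so that
    \<open>b = g w + h w\<close>, of integral 2, uses up exactly half of \<open>r\<close>.\<close>
  have amgm: "s w \<le> r / 4 * b + a / r" if "(s w)\<^sup>2 \<le> a * b" "0 \<le> a" "0 \<le> b" for w a b
  proof -
    have "(s w)\<^sup>2 \<le> (r / 4 * b + a / r)\<^sup>2"
    proof -
      have "(r / 4 * b + a / r)\<^sup>2 = a * b + (r / 4 * b - a / r)\<^sup>2"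
        using r by (simp add: power2_eq_square field_simps)
      moreover have "0 \<le> (r / 4 * b - a / r)\<^sup>2" by simp
      ultimately show ?thesis using that(1) by linarith
    qed
    moreover have "0 \<le> r / 4 * b + a / r"
      using that(2,3) r by (intro add_nonneg_nonneg mult_nonneg_nonneg divide_nonneg_nonneg) simp_all
    ultimately show ?thesis by (rule power2_le_imp_le)
  qed
  have "(\<integral>w. s w \<partial>M)
      \<le> (\<integral>w. r / 4 * (g w + h w) + (g w * indicator A w + h w * indicator B w) / r \<partial>M)"
  proof (rule integral_mono[OF int(3)])
    show "integrable M (\<lambda>w. r / 4 * (g w + h w) + (g w * indicator A w + h w * indicator B w) / r)"
      using int iA by simp
  next
    fix w assume w: "w \<in> space M"
    have gh: "0 \<le> g w" "0 \<le> h w" "(s w)\<^sup>2 = g w * h w" using nonneg s w by auto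
    have AB': "w \<in> A \<or> w \<in> B" using AB w by auto
    have nn: "0 \<le> g w * g w" "0 \<le> h w * h w" "0 \<le> g w * h w"
      using gh(1,2) by simp_all
    show "s w \<le> r / 4 * (g w + h w) + (g w * indicator A w + h w * indicator B w) / r"
    proof (rule amgm)
      \<comment> \<open>At least one of \<open>g w\<close>, \<open>h w\<close> survives in the first
        factor, and the second factor supplies the other one.\<close>
      show "(s w)\<^sup>2 \<le> (g w * indicator A w + h w * indicator B w) * (g w + h w)"
        unfolding gh(3) using AB' nn
        by (cases "w \<in> A"; cases "w \<in> B") (auto simp: algebra_simps)
    qed (use gh(1,2) in auto)
  qed
  also have "\<dots> = r / 4 * 2 + ((\<integral>w. g w * indicator A w \<partial>M) + (\<integral>w. h w * indicator B w \<partial>M)) / r"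
    using int iA one by simp
  finally show ?thesis
    using r unfolding r_def[symmetric] by (simp add: field_simps power2_eq_square)
qed

text \<open>Both measures factor over rectangles, and rectangles determine a finite product of
  sigma-finite measures. This turns the law of an i.i.d. sample into a likelihood ratio against a
  product reference law.\<close>

lemma PiM_density:
  fixes N :: "'i \<Rightarrow> 'a measure" and g :: "'i \<Rightarrow> 'a \<Rightarrow> real"
  assumes fin: "finite I"
    and N: "\<And>i. prob_space (N i)"
    and g: "\<And>i. g i \<in> borel_measurable (N i)" "\<And>i w. 0 \<le> g i w"
    and prob: "\<And>i. prob_space (density (N i) (\<lambda>w. ennreal (g i w)))"
  shows "(\<Pi>\<^sub>M i\<in>I. density (N i) (\<lambda>w. ennreal (g i w)))
    = density (\<Pi>\<^sub>M i\<in>I. N i) (\<lambda>X. ennreal (\<Prod>i\<in>I. g i (X i)))"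
proof -
  interpret N: product_sigma_finite N
    using N by (simp add: product_sigma_finite_def prob_space_imp_sigma_finite)
  interpret D: product_sigma_finite "\<lambda>i. density (N i) (\<lambda>w. ennreal (g i w))"
    using prob by (simp add: product_sigma_finite_def prob_space_imp_sigma_finite)
  note g(1)[measurable]
  have "density (\<Pi>\<^sub>M i\<in>I. N i) (\<lambda>X. ennreal (\<Prod>i\<in>I. g i (X i)))
      = (\<Pi>\<^sub>M i\<in>I. density (N i) (\<lambda>w. ennreal (g i w)))"
  proof (rule D.PiM_eqI[OF fin])
    show "sets (density (Pi\<^sub>M I N) (\<lambda>X. ennreal (\<Prod>i\<in>I. g i (X i))))
        = sets (\<Pi>\<^sub>M i\<in>I. density (N i) (\<lambda>w. ennreal (g i w)))"
      by (simp cong: sets_PiM_cong)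
  next
    fix A assume "\<And>i. i \<in> I \<Longrightarrow> A i \<in> sets (density (N i) (\<lambda>w. ennreal (g i w)))"
    hence A: "\<And>i. i \<in> I \<Longrightarrow> A i \<in> sets (N i)" by simp
    have "emeasure (density (Pi\<^sub>M I N) (\<lambda>X. ennreal (\<Prod>i\<in>I. g i (X i)))) (Pi\<^sub>E I A)
        = (\<integral>\<^sup>+X. ennreal (\<Prod>i\<in>I. g i (X i)) * indicator (Pi\<^sub>E I A) X \<partial>Pi\<^sub>M I N)"
      using A fin by (subst emeasure_density) (auto intro!: sets_PiM_I_finite)
    also have "\<dots> = (\<integral>\<^sup>+X. (\<Prod>i\<in>I. ennreal (g i (X i)) * indicator (A i) (X i)) \<partial>Pi\<^sub>M I N)"
    proof (rule nn_integral_cong)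
      fix X assume "X \<in> space (Pi\<^sub>M I N)"
      hence "indicator (Pi\<^sub>E I A) X = (\<Prod>i\<in>I. indicator (A i) (X i) :: ennreal)"
        using fin by (auto simp: space_PiM PiE_iff indicator_def)
      then show "ennreal (\<Prod>i\<in>I. g i (X i)) * indicator (Pi\<^sub>E I A) X
          = (\<Prod>i\<in>I. ennreal (g i (X i)) * indicator (A i) (X i))"
        using g(2) by (simp add: prod.distrib prod_ennreal)
    qed
    also have "\<dots> = (\<Prod>i\<in>I. \<integral>\<^sup>+w. ennreal (g i w) * indicator (A i) w \<partial>N i)"
      using A by (intro N.product_nn_integral_prod fin) auto
    also have "\<dots> = (\<Prod>i\<in>I. emeasure (density (N i) (\<lambda>w. ennreal (g i w))) (A i))"
      using A by (intro prod.cong refl emeasure_density[symmetric]) auto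
    finally show "emeasure (density (Pi\<^sub>M I N) (\<lambda>X. ennreal (\<Prod>i\<in>I. g i (X i)))) (Pi\<^sub>E I A)
        = (\<Prod>i\<in>I. emeasure (density (N i) (\<lambda>w. ennreal (g i w))) (A i))" .
  qed
  then show ?thesis by simp
qed

section \<open>Likelihood ratios of sign perturbations\<close>

text \<open>Pairwise orthogonality is enough for the testing bounds: second moments and affinities
  of the densities \<open>1 + \<gamma> * e j\<close> involve products of at most two signs. Mean
  zero and orthogonality are restricted to \<open>I\<close> because the Rademacher function of index
  0 is constant on the slab.\<close>

locale orthogonal_signs = prob_space Q for Q :: "'a measure" +
  fixes e :: "'i \<Rightarrow> 'a \<Rightarrow> real" and I :: "'i set"
  assumes meas [measurable]: "\<And>j. e j \<in> borel_measurable Q"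
    and sign: "\<And>j w. e j w = 1 \<or> e j w = -1"
    and mean: "\<And>j. j \<in> I \<Longrightarrow> (\<integral>w. e j w \<partial>Q) = 0"
    and orth: "\<And>j k. j \<in> I \<Longrightarrow> k \<in> I \<Longrightarrow> j \<noteq> k \<Longrightarrow> (\<integral>w. e j w * e k w \<partial>Q) = 0"
begin

lemma square_sign: "e j w * e j w = 1"
  using sign[of j w] by auto

lemma integrable_sign: "integrable Q (e j)"
proof (rule integrable_const_bound[where B=1])
  show "AE w in Q. norm (e j w) \<le> 1"
  proof (rule AE_I2)
    fix w show "norm (e j w) \<le> 1" using sign[of j w] by auto
  qed
qed auto

lemma integrable_sign_mult: "integrable Q (\<lambda>w. e j w * e k w)"
proof (rule integrable_const_bound[where B=1])
  show "AE w in Q. norm (e j w * e k w) \<le> 1"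
  proof (rule AE_I2)
    fix w show "norm (e j w * e k w) \<le> 1" using sign[of j w] sign[of k w] by auto
  qed
qed auto

text \<open>Likelihood ratio, against the \<open>n\<close>-fold product of \<open>Q\<close>, of
  \<open>n\<close> independent observations with density \<open>1 + \<gamma> * e j\<close> relative
  to \<open>Q\<close>.\<close>

definition lr :: "real \<Rightarrow> nat \<Rightarrow> 'i \<Rightarrow> (nat \<Rightarrow> 'a) \<Rightarrow> real"
  where "lr \<gamma> n j X = (\<Prod>i\<in>{1..n}. 1 + \<gamma> * e j (X i))"

sublocale PQ: product_prob_space "\<lambda>_::nat. Q" "{1..n}" for n ..

lemma integral_single:
  assumes "j \<in> I"
  shows "integrable Q (\<lambda>w. 1 + \<gamma> * e j w)" "(\<integral>w. 1 + \<gamma> * e j w \<partial>Q) = 1"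
  using integrable_sign[of j] mean[OF assms] by (auto simp: prob_space)

lemma lr_nonneg: "0 \<le> \<gamma> \<Longrightarrow> \<gamma> \<le> 1 \<Longrightarrow> 0 \<le> lr \<gamma> n j X"
  unfolding lr_def
proof (rule prod_nonneg)
  fix i assume "0 \<le> \<gamma>" "\<gamma> \<le> 1"
  then show "0 \<le> 1 + \<gamma> * e j (X i)" using sign[of j "X i"] by auto
qed

lemma integral_lr:
  assumes "j \<in> I"
  shows "integrable (\<Pi>\<^sub>M i\<in>{1..n}. Q) (lr \<gamma> n j)"
    and "(\<integral>X. lr \<gamma> n j X \<partial>(\<Pi>\<^sub>M i\<in>{1..n}. Q)) = 1"
proof -
  note int = integral_single[OF assms, of \<gamma>]
  show "integrable (\<Pi>\<^sub>M i\<in>{1..n}. Q) (lr \<gamma> n j)"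
    unfolding lr_def by (rule PQ.product_integrable_prod) (auto simp: int(1))
  show "(\<integral>X. lr \<gamma> n j X \<partial>(\<Pi>\<^sub>M i\<in>{1..n}. Q)) = 1"
    unfolding lr_def by (subst PQ.product_integral_prod) (simp_all add: int)
qed

text \<open>A sign squares to 1, so \<open>(1 + \<gamma> * e j w)\<^sup>2\<close> is affine in the
  sign and each factor integrates to \<open>1 + \<gamma>\<^sup>2\<close>.\<close>

lemma integral_lr_square:
  assumes j: "j \<in> I"
  shows "integrable (\<Pi>\<^sub>M i\<in>{1..n}. Q) (\<lambda>X. (lr \<gamma> n j X)\<^sup>2)"
    and "(\<integral>X. (lr \<gamma> n j X)\<^sup>2 \<partial>(\<Pi>\<^sub>M i\<in>{1..n}. Q)) = (1 + \<gamma>\<^sup>2) ^ n"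
proof -
  have sq: "(1 + \<gamma> * e j w)\<^sup>2 = 1 + \<gamma>\<^sup>2 + 2 * \<gamma> * e j w" for w
    using sign[of j w] by (auto simp: power2_eq_square algebra_simps)
  have int: "integrable Q (\<lambda>w. (1 + \<gamma> * e j w)\<^sup>2)"
    and eq: "(\<integral>w. (1 + \<gamma> * e j w)\<^sup>2 \<partial>Q) = 1 + \<gamma>\<^sup>2"
    unfolding sq using integrable_sign[of j] mean[OF j] by (auto simp: prob_space)
  show "integrable (\<Pi>\<^sub>M i\<in>{1..n}. Q) (\<lambda>X. (lr \<gamma> n j X)\<^sup>2)"
    unfolding lr_def prod_power_distrib
    by (rule PQ.product_integrable_prod) (auto simp only: int finite_atLeastAtMost)
  show "(\<integral>X. (lr \<gamma> n j X)\<^sup>2 \<partial>(\<Pi>\<^sub>M i\<in>{1..n}. Q)) = (1 + \<gamma>\<^sup>2) ^ n"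
    unfolding lr_def prod_power_distrib
    by (subst PQ.product_integral_prod) (simp_all add: int eq)
qed

text \<open>On signs, \<open>sqrt (1 + \<gamma> e)\<close> is the affine function \<open>s + d e\<close> with the two values below, so the
  Hellinger affinity of two perturbations is \<open>s\<^sup>2\<close>.\<close>

lemma sqrt_lr:
  assumes j: "j \<in> I" and k: "k \<in> I" and jk: "j \<noteq> k" and \<gamma>: "0 \<le> \<gamma>" "\<gamma> \<le> 1"
  obtains s where
    "integrable (\<Pi>\<^sub>M i\<in>{1..n}. Q) s"
    "\<And>X. (s X)\<^sup>2 = lr \<gamma> n j X * lr \<gamma> n k X"
    "(\<integral>X. s X \<partial>(\<Pi>\<^sub>M i\<in>{1..n}. Q)) = ((1 + sqrt (1 - \<gamma>\<^sup>2)) / 2) ^ n"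
proof -
  define s where "s = (sqrt (1 + \<gamma>) + sqrt (1 - \<gamma>)) / 2"
  define d where "d = (sqrt (1 + \<gamma>) - sqrt (1 - \<gamma>)) / 2"
  define r where "r w = (s + d * e j w) * (s + d * e k w)" for w
  have sd: "(s + d * e l w)\<^sup>2 = 1 + \<gamma> * e l w" for l w
    using sign[of l w] \<gamma> by (auto simp: s_def d_def power2_eq_square field_simps)
  have r: "r w = s\<^sup>2 + s * d * e j w + s * d * e k w + d\<^sup>2 * (e j w * e k w)" for w
    by (simp add: r_def power2_eq_square algebra_simps)
  have ss: "s\<^sup>2 = (1 + sqrt (1 - \<gamma>\<^sup>2)) / 2"
  proof -
    have "sqrt (1 - \<gamma>\<^sup>2) = sqrt (1 + \<gamma>) * sqrt (1 - \<gamma>)"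
      by (simp add: real_sqrt_mult[symmetric] power2_eq_square algebra_simps)
    then show ?thesis using \<gamma> by (simp add: s_def power2_eq_square field_simps)
  qed
  have int: "integrable Q r" and eq: "(\<integral>w. r w \<partial>Q) = (1 + sqrt (1 - \<gamma>\<^sup>2)) / 2"
    unfolding r ss[symmetric]
    using integrable_sign[of j] integrable_sign[of k] integrable_sign_mult[of j k]
      mean[OF j] mean[OF k] orth[OF j k jk] by (auto simp: prob_space)
  show ?thesis
  proof
    show "integrable (\<Pi>\<^sub>M i\<in>{1..n}. Q) (\<lambda>X. \<Prod>i\<in>{1..n}. r (X i))"
      using int by (intro PQ.product_integrable_prod) auto
    show "(\<integral>X. (\<Prod>i\<in>{1..n}. r (X i)) \<partial>(\<Pi>\<^sub>M i\<in>{1..n}. Q)) = ((1 + sqrt (1 - \<gamma>\<^sup>2)) / 2) ^ n"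
      using int by (subst PQ.product_integral_prod) (auto simp: eq)
    show "(\<Prod>i\<in>{1..n}. r (X i))\<^sup>2 = lr \<gamma> n j X * lr \<gamma> n k X" for X
      unfolding lr_def prod_power_distrib prod.distrib[symmetric] r_def power_mult_distrib sd ..
  qed
qed


text \<open>With \<open>u = \<gamma>\<^sup>2\<close>, convexity puts \<open>2 powr (- u)\<close>
  below its chord \<open>1 - u / 2\<close> on the unit interval, and
  \<open>1 - u \<le> sqrt (1 - u)\<close>. Both estimates are sharp at \<open>u = 0\<close> and
  \<open>u = 1\<close>.\<close>

lemma affinity_power_ge:
  assumes \<gamma>: "0 \<le> \<gamma>" "\<gamma> \<le> 1"
  shows "exp (- real n * \<gamma>\<^sup>2 * ln 2) \<le> ((1 + sqrt (1 - \<gamma>\<^sup>2)) / 2) ^ n"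
proof -
  define u where "u = \<gamma>\<^sup>2"
  have u: "0 \<le> u" "u \<le> 1"
    using \<gamma> by (auto simp: u_def power_le_one)
  have "exp (- (u * ln 2)) = exp ((1 - u) *\<^sub>R 0 + u *\<^sub>R (- ln 2))" by simp
  also have "\<dots> \<le> (1 - u) * exp 0 + u * exp (- ln 2)"
    using u by (intro convex_onD[OF exp_convex]) auto
  also have "\<dots> = (1 + (1 - u)) / 2"
    by (simp add: exp_minus field_simps)
  also have "1 - u \<le> sqrt (1 - u)"
    using u by (intro real_le_rsqrt) (simp add: power2_eq_square mult_left_le)
  finally have "exp (- (u * ln 2)) ^ n \<le> ((1 + sqrt (1 - u)) / 2) ^ n"
    by (intro power_mono) auto
  also have "exp (- (u * ln 2)) ^ n = exp (- real n * u * ln 2)"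
    by (simp add: exp_of_nat_mult[symmetric] mult.assoc)
  finally show ?thesis unfolding u_def .
qed

text \<open>The integral is the probability, under hypothesis \<open>j\<close>, that
  \<open>J\<close> misses \<open>j\<close>. The factor 1/3 in \<open>n * \<gamma>\<^sup>2\<close>
  serves both regimes: it keeps \<open>C\<close> below \<open>card I powr (2 / 3)\<close> in the
  first and the affinity above \<open>exp (- x / 2)\<close> in the second.\<close>

lemma identification_error_ge:
  assumes fin: "finite I" and card: "2 \<le> card I" and x: "0 \<le> x"
    and \<gamma>: "0 \<le> \<gamma>" "\<gamma> \<le> 1" and n: "n * \<gamma>\<^sup>2 = (x + ln (card I)) / 3"
    and J: "J \<in> (\<Pi>\<^sub>M i\<in>{1..n}. Q) \<rightarrow>\<^sub>M count_space I"
  shows "\<exists>j\<in>I. exp (- x) / 24 \<le> (\<integral>X. lr \<gamma> n j X * indicator {X. J X \<noteq> j} X \<partial>(\<Pi>\<^sub>M i\<in>{1..n}. Q))"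
proof -
  let ?P = "\<Pi>\<^sub>M i\<in>{1..n}. Q"
  define err where "err j = (\<integral>X. lr \<gamma> n j X * indicator {X. J X \<noteq> j} X \<partial>?P)" for j
  have ev: "{X \<in> space ?P. J X \<noteq> j} \<in> sets ?P" if "j \<in> I" for j
  proof -
    have "J -` (I - {j}) \<inter> space ?P \<in> sets ?P" by (rule measurable_sets[OF J]) auto
    also have "J -` (I - {j}) \<inter> space ?P = {X \<in> space ?P. J X \<noteq> j}"
      using measurable_space[OF J] by auto
    finally show ?thesis .
  qed
  have err: "err j = (\<integral>X. lr \<gamma> n j X * indicator {X \<in> space ?P. J X \<noteq> j} X \<partial>?P)" for j
    unfolding err_def by (intro Bochner_Integration.integral_cong) (auto simp: indicator_def)
  have "\<exists>j\<in>I. exp (- x) / 24 \<le> err j"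
  proof (cases "x \<le> ln (card I)")
    case True
    define K where "K = real (card I)"
    define C where "C = (1 + \<gamma>\<^sup>2) ^ n"
    have K: "2 \<le> K" using card by (simp add: K_def)
    have C: "0 < C" unfolding C_def by (intro zero_less_power add_pos_nonneg) auto
    have "C \<le> exp (\<gamma>\<^sup>2) ^ n"
      unfolding C_def by (intro power_mono exp_ge_add_one_self) auto
    also have "\<dots> = exp ((x + ln K) / 3)"
      using n by (simp add: exp_of_nat_mult[symmetric] K_def)
    also have "\<dots> \<le> exp (2 / 3 * ln K)"
      using True by (simp add: K_def)
    \<comment> \<open>Cubing clears the exponent 2/3.\<close>
    finally have "C ^ 3 \<le> exp (2 / 3 * ln K) ^ 3"
      using C by (intro power_mono) auto
    also have "\<dots> = K\<^sup>2"
      using K by (simp add: exp_of_nat_mult[symmetric] powr_def flip: powr_numeral)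
    finally have C3: "C ^ 3 \<le> K\<^sup>2" .
    have succ: "(\<integral>X. lr \<gamma> n j X * indicator {X. J X = j} X \<partial>?P) = 1 - err j" if j: "j \<in> I" for j
    proof -
      have "(\<integral>X. lr \<gamma> n j X * indicator {X. J X = j} X \<partial>?P)
          = (\<integral>X. lr \<gamma> n j X - lr \<gamma> n j X * indicator {X \<in> space ?P. J X \<noteq> j} X \<partial>?P)"
        by (intro Bochner_Integration.integral_cong) (auto simp: indicator_def)
      also have "\<dots> = 1 - err j"
        using integral_lr[OF j, of n \<gamma>] integrable_mult_indicator[OF ev[OF j] integral_lr(1)[OF j, of n \<gamma>]]
        by (simp add: err mult.commute)
      finally show ?thesis .
    qed
    show ?thesis
    proof (rule ccontr)
      assume "\<not> ?thesis"
      \<comment> \<open>As \<open>0 \<le> x\<close>, the violated bound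
        \<open>exp (- x) / 24\<close> is at most 1/24, so every success probability exceeds
        23/24.\<close>
      hence small: "err j < 1 / 24" if "j \<in> I" for j
        using that x by (force simp: not_le intro: less_le_trans)
      have "K * (23 / 24) = (\<Sum>j\<in>I. 23 / 24)" by (simp add: K_def)
      also have "\<dots> \<le> (\<Sum>j\<in>I. \<integral>X. lr \<gamma> n j X * indicator {X. J X = j} X \<partial>?P)"
      proof (rule sum_mono)
        fix j assume "j \<in> I"
        then show "23 / 24 \<le> (\<integral>X. lr \<gamma> n j X * indicator {X. J X = j} X \<partial>?P)"
          using small[of j] succ[of j] by linarith
      qed
      also have "\<dots> \<le> sqrt (K * C)"
        unfolding K_def
        using fin card C J integral_lr(1) integral_lr_square
        by (intro PQ.sum_success_le) (auto simp: C_def)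
      finally have "(K * (23 / 24))\<^sup>2 \<le> (sqrt (K * C))\<^sup>2"
        using K by (intro power_mono) auto
      hence "K * (K * (23 / 24)\<^sup>2) \<le> K * C"
        using K C by (simp add: power2_eq_square mult_ac)
      hence "K * (23 / 24)\<^sup>2 \<le> C"
        using K by (simp only: mult_le_cancel_left_pos)
      hence "(K * (23 / 24)\<^sup>2) ^ 3 \<le> C ^ 3"
        using K by (intro power_mono) auto
      moreover have cube: "(K * q\<^sup>2) ^ 3 = K\<^sup>2 * (K * q ^ 6)" for q :: real
        by (simp add: eval_nat_numeral mult_ac)
      ultimately have "K\<^sup>2 * (K * (23 / 24) ^ 6) \<le> K\<^sup>2 * 1"
        using C3 unfolding cube by linarith
      \<comment> \<open>Impossible for \<open>2 \<le> K\<close>, since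
        \<open>2 * (23 / 24) ^ 6\<close> exceeds 1.\<close>
      hence "K * (23 / 24) ^ 6 \<le> 1"
        using K by (subst (asm) mult_le_cancel_left_pos) auto
      then show False using K by (simp add: power_divide)
    qed
  next
    case False
    obtain j where j: "j \<in> I" using card by fastforce
    have "I - {j} \<noteq> {}" using card card_mono[of "{j}" I] by fastforce
    then obtain k where k: "k \<in> I" and jk: "j \<noteq> k" by auto
    obtain s where s: "integrable ?P s" "\<And>X. (s X)\<^sup>2 = lr \<gamma> n j X * lr \<gamma> n k X"
      "(\<integral>X. s X \<partial>?P) = ((1 + sqrt (1 - \<gamma>\<^sup>2)) / 2) ^ n"
      using sqrt_lr[OF j k jk \<gamma>, of n] by metis
    have ge: "exp (- real n * \<gamma>\<^sup>2 * ln 2) \<le> (\<integral>X. s X \<partial>?P)"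
      unfolding s(3) by (rule affinity_power_ge[OF \<gamma>])
    have pos: "0 < (\<integral>X. s X \<partial>?P)"
      by (rule less_le_trans[OF exp_gt_zero ge])
    \<comment> \<open>Here \<open>ln (card I) < x\<close>, hence
      \<open>n * \<gamma>\<^sup>2 \<le> 2 / 3 * x\<close>. The product is
      \<open>25 / 54 * x\<close>, less than \<open>x / 2\<close>, so the squared affinity stays
      above \<open>exp (- x)\<close>.\<close>
    have "real n * \<gamma>\<^sup>2 * ln 2 \<le> (2 / 3 * x) * (25 / 36)"
      unfolding n using False x ln2_le_25_over_36 by (intro mult_mono) auto
    hence "exp (- x) \<le> exp (- real n * \<gamma>\<^sup>2 * ln 2) ^ 2"
      using x by (simp add: exp_of_nat_mult[symmetric])
    also have "\<dots> \<le> (\<integral>X. s X \<partial>?P)\<^sup>2"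
      using ge by (intro power_mono) auto
    finally have "exp (- x) / 2 \<le> (\<integral>X. s X \<partial>?P)\<^sup>2 / 2" by simp
    also have "\<dots> \<le> err j + err k"
      unfolding err
      using jk
      by (intro two_point_error_ge integral_lr ev lr_nonneg s j k \<gamma> pos) auto
    finally have "exp (- x) / 24 \<le> err j \<or> exp (- x) / 24 \<le> err k"
      using exp_gt_zero[of "- x"] by linarith
    then show ?thesis using j k by blast
  qed
  then show ?thesis by (simp add: err_def)
qed

end

section \<open>Rademacher functions on a slab\<close>

text \<open>The half-open sides let a translation match the dyadic layers along the axis
  \<open>k\<close> exactly, with no exceptional null set.\<close>

definition slab :: "'d::finite \<Rightarrow> real \<Rightarrow> (real ^ 'd) set" where
  "slab k w = {x. \<forall>i. 0 \<le> x $ i \<and> x $ i < (if i = k then w else 1)}"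

definition uniform_slab :: "'d::finite \<Rightarrow> real \<Rightarrow> (real ^ 'd) measure" where
  "uniform_slab k w = density lborel (\<lambda>x. ennreal (indicator (slab k w) x / w))"

text \<open>On the slab this sign reads the \<open>j\<close>-th binary digit of
  \<open>x $ k / w\<close>, counted from 1; for \<open>j = 0\<close> it is constantly 1 there. It is
  defined on the whole space so that the shift identities hold everywhere.\<close>

definition rademacher :: "'d::finite \<Rightarrow> real \<Rightarrow> nat \<Rightarrow> real ^ 'd \<Rightarrow> real" where
  "rademacher k w j x = (if even \<lfloor>2 ^ j * (x $ k) / w\<rfloor> then 1 else -1)"

lemma slab_borel [measurable]: "slab k w \<in> sets borel"
  unfolding slab_def by measurable

lemma rademacher_borel [measurable]: "rademacher k w j \<in> borel_measurable borel"
  unfolding rademacher_def by measurable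

text \<open>The slab is squeezed between an open and a closed box of equal volume.\<close>

lemma emeasure_slab:
  fixes k :: "'d::finite"
  assumes w: "w > 0"
  shows "emeasure lborel (slab k w) = ennreal w"
proof -
  define b :: "real ^ 'd" where "b = (\<chi> i. if i = k then w else 1)"
  have pr: "(\<Prod>i\<in>Basis. b \<bullet> i) = w"
  proof -
    have "(\<Prod>i\<in>Basis. b \<bullet> i) = (\<Prod>i\<in>UNIV. b $ i)"
      by (simp add: Basis_vec_def cart_eq_inner_axis axis_eq_axis prod.UNION_disjoint)
    also have "\<dots> = (\<Prod>i\<in>UNIV. if i = k then w else 1)" by (simp add: b_def)
    also have "\<dots> = w" by simp
    finally show ?thesis .
  qed
  have le: "\<forall>i\<in>Basis. (0 :: real ^ 'd) \<bullet> i \<le> b \<bullet> i"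
    using w by (auto simp: Basis_vec_def b_def inner_axis)
  have "emeasure lborel (box 0 b) \<le> emeasure lborel (slab k w)"
    by (rule emeasure_mono) (force simp: slab_def mem_box_cart b_def less_imp_le)+
  moreover have "emeasure lborel (slab k w) \<le> emeasure lborel (cbox 0 b)"
    by (rule emeasure_mono) (auto simp: slab_def mem_box_cart b_def less_imp_le)
  ultimately show ?thesis
    using le by (simp add: emeasure_lborel_box_eq emeasure_lborel_cbox_eq pr)
qed

lemma space_uniform_slab [simp]: "space (uniform_slab k w) = UNIV"
  and sets_uniform_slab [simp, measurable_cong]: "sets (uniform_slab k w) = sets borel"
  by (simp_all add: uniform_slab_def)

lemma prob_space_uniform_slab:
  assumes w: "w > 0"
  shows "prob_space (uniform_slab k w)"
proof
  have "emeasure (uniform_slab k w) (space (uniform_slab k w))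
      = (\<integral>\<^sup>+x. ennreal (1 / w) * indicator (slab k w) x \<partial>lborel)"
    unfolding uniform_slab_def
    by (subst emeasure_density) (auto intro!: nn_integral_cong simp: indicator_def)
  also have "\<dots> = 1"
    using w by (subst nn_integral_cmult_indicator) (auto simp: emeasure_slab ennreal_mult[symmetric])
  finally show "emeasure (uniform_slab k w) (space (uniform_slab k w)) = 1" .
qed

lemma integral_uniform_slab:
  fixes F :: "real ^ 'd \<Rightarrow> real"
  assumes "w > 0" and "F \<in> borel_measurable borel"
  shows "(\<integral>x. F x \<partial>uniform_slab k w) = (\<integral>x. indicator (slab k w) x * F x \<partial>lborel) / w"
  using assms unfolding uniform_slab_def by (subst integral_density) auto

text \<open>Translation by \<open>w / 2 ^ j\<close> along the axis \<open>k\<close> carries the part of the slab where the \<open>j\<close>-th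
  binary digit is \<open>0\<close> onto the part where it is \<open>1\<close>.\<close>

lemma integral_antiperiodic_eq_0:
  fixes F :: "real ^ 'd \<Rightarrow> real"
  assumes w: "w > 0" and j: "j \<ge> 1"
    and int: "integrable lborel (\<lambda>x. indicator (slab k w) x * F x)"
    and meas [measurable]: "F \<in> borel_measurable borel"
    and anti: "\<And>x. F (axis k (w / 2 ^ j) + x) = - F x"
  shows "(\<integral>x. indicator (slab k w) x * F x \<partial>lborel) = 0"
proof -
  define h where "h = (axis k (w / 2 ^ j) :: real ^ 'd)"
  define v where "v x = 2 ^ j * (x $ k) / w" for x :: "real ^ 'd"
  have [measurable]: "v \<in> borel_measurable borel" unfolding v_def by measurable
  define E where "E = {x \<in> slab k w. even \<lfloor>v x\<rfloor>}"
  define D where "D = {x \<in> slab k w. odd \<lfloor>v x\<rfloor>}"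
  have [measurable]: "E \<in> sets borel" "D \<in> sets borel"
    unfolding E_def D_def by measurable
  have comp: "v (h + x) = v x + 1" for x
    using w by (simp add: v_def h_def field_simps)
  have slab_v: "x \<in> slab k w \<longleftrightarrow> (0 \<le> v x \<and> v x < 2 ^ j) \<and> (\<forall>i. i \<noteq> k \<longrightarrow> 0 \<le> x $ i \<and> x $ i < 1)" for x
  proof -
    have c: "0 < 2 ^ j / w" using w by simp
    have v: "v x = (2 ^ j / w) * (x $ k)" "2 ^ j = (2 ^ j / w) * w"
      using w by (simp_all add: v_def)
    have "0 \<le> v x \<longleftrightarrow> 0 \<le> x $ k" "v x < 2 ^ j \<longleftrightarrow> x $ k < w"
      unfolding v(1) using c zero_le_mult_iff[of "2 ^ j / w" "x $ k"]
        mult_less_cancel_left_pos[OF c, of "x $ k" w] v(2) by auto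
    then show ?thesis by (auto simp: slab_def)
  qed
  have ev: "even (2 ^ j :: int)" using j by simp
  have floor_lt: "v x < 2 ^ j \<longleftrightarrow> \<lfloor>v x\<rfloor> < 2 ^ j" for x
    by (simp add: floor_less_iff)
  have shift: "h + x \<in> D \<longleftrightarrow> x \<in> E" for x
  proof -
    have other: "(h + x) $ i = x $ i" if "i \<noteq> k" for i
      using that by (simp add: h_def axis_def)
    have fl: "\<lfloor>v (h + x)\<rfloor> = \<lfloor>v x\<rfloor> + 1" by (simp add: comp)
    \<comment> \<open>An even floor is neither \<open>-1\<close> nor \<open>2 ^ j - 1\<close>, the
      only values at which adding 1 crosses an end of the range. Here \<open>j \<ge> 1\<close> makes
      \<open>2 ^ j\<close> even.\<close>
    have "0 \<le> \<lfloor>v x\<rfloor> + 1 \<and> \<lfloor>v x\<rfloor> + 1 < 2 ^ j \<longleftrightarrow> 0 \<le> \<lfloor>v x\<rfloor> \<and> \<lfloor>v x\<rfloor> < 2 ^ j" if "even \<lfloor>v x\<rfloor>"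
    proof -
      have "\<lfloor>v x\<rfloor> + 1 \<noteq> 2 ^ j" "\<lfloor>v x\<rfloor> + 1 \<noteq> 0"
        using that ev by (metis even_plus_one_iff, metis even_plus_one_iff even_zero)
      then show ?thesis by linarith
    qed
    then show ?thesis
      unfolding D_def E_def mem_Collect_eq slab_v floor_lt fl zero_le_floor[symmetric]
      using other by auto
  qed
  have iE: "integrable lborel (\<lambda>x. indicator E x * F x)"
    using integrable_mult_indicator[of E lborel, OF _ int]
    by (rule Bochner_Integration.integrable_cong[THEN iffD1, rotated -1]) (auto simp: E_def indicator_def)
  have iD: "integrable lborel (\<lambda>x. indicator D x * F x)"
    using integrable_mult_indicator[of D lborel, OF _ int]
    by (rule Bochner_Integration.integrable_cong[THEN iffD1, rotated -1]) (auto simp: D_def indicator_def)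
  have "(\<integral>x. indicator D x * F x \<partial>lborel) = (\<integral>x. indicator D x * F x \<partial>distr lborel borel ((+) h))"
    by (simp add: lborel_distr_plus)
  also have "\<dots> = (\<integral>x. indicator D (h + x) * F (h + x) \<partial>lborel)"
    by (rule integral_distr) auto
  also have "\<dots> = (\<integral>x. - (indicator E x * F x) \<partial>lborel)"
    using anti by (intro Bochner_Integration.integral_cong) (auto simp: indicator_def shift h_def[symmetric])
  finally have D: "(\<integral>x. indicator D x * F x \<partial>lborel) = - (\<integral>x. indicator E x * F x \<partial>lborel)"
    by simp
  have "(\<integral>x. indicator (slab k w) x * F x \<partial>lborel)
      = (\<integral>x. indicator E x * F x + indicator D x * F x \<partial>lborel)"
    by (intro Bochner_Integration.integral_cong) (auto simp: E_def D_def indicator_def)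
  also have "\<dots> = 0"
    using iE iD D by simp
  finally show ?thesis .
qed

lemma rademacher_cases: "rademacher k w j x = 1 \<or> rademacher k w j x = -1"
  by (simp add: rademacher_def)

lemma rademacher_antiperiodic:
  assumes "w > 0"
  shows "rademacher k w j (axis k (w / 2 ^ j) + x) = - rademacher k w j x"
proof -
  have "2 ^ j * ((axis k (w / 2 ^ j) + x) $ k) / w = 2 ^ j * (x $ k) / w + 1"
    using assms by (simp add: field_simps)
  then show ?thesis by (simp add: rademacher_def)
qed

text \<open>The shift that flips the sign of index \<open>i\<close> moves the argument of the finer
  one by the even number \<open>2 ^ (j - i)\<close>. The product of the two signs is therefore
  antiperiodic.\<close>

lemma rademacher_periodic:
  assumes w: "w > 0" and "i < j"
  shows "rademacher k w j (axis k (w / 2 ^ i) + x) = rademacher k w j x"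
proof -
  obtain m where m: "j = Suc (i + m)" using \<open>i < j\<close> by (metis less_iff_Suc_add)
  have "2 ^ j * ((axis k (w / 2 ^ i) + x) $ k) / w = 2 ^ j * (x $ k) / w + of_int (2 * 2 ^ m)"
    using w by (simp add: m field_simps power_add)
  then have "\<lfloor>2 ^ j * ((axis k (w / 2 ^ i) + x) $ k) / w\<rfloor> = \<lfloor>2 ^ j * (x $ k) / w\<rfloor> + 2 * 2 ^ m"
    by (simp only: floor_add_int[symmetric])
  then show ?thesis by (simp add: rademacher_def)
qed

lemma integrable_on_slab:
  fixes F :: "real ^ 'd \<Rightarrow> real"
  assumes "w > 0" and "F \<in> borel_measurable borel" and "\<And>x. \<bar>F x\<bar> \<le> B"
  shows "integrable lborel (\<lambda>x. indicator (slab k w) x * F x)"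
proof (rule Bochner_Integration.integrable_bound)
  show "integrable lborel (\<lambda>x. B * indicator (slab k w) x)"
    using assms(1) by (auto simp: emeasure_slab)
  have "\<bar>indicator (slab k w) x * F x\<bar> \<le> \<bar>B * indicator (slab k w) x\<bar>" for x
    using assms(3)[of x] by (auto simp: indicator_def)
  then show "AE x in lborel. norm (indicator (slab k w) x * F x) \<le> norm (B * indicator (slab k w) x)"
    by (intro AE_I2) simp
qed (use assms(2) in measurable)

lemma orthogonal_signs_rademacher:
  fixes k :: "'d::finite"
  assumes w: "w > 0"
  shows "orthogonal_signs (uniform_slab k w) (rademacher k w) {1..M}"
proof -
  interpret prob_space "uniform_slab k w" by (rule prob_space_uniform_slab[OF w])
  \<comment> \<open>The shift belonging to the coarser index \<open>i\<close> flips the product, so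
    its integral over the slab vanishes.\<close>
  have lt: "(\<integral>x. rademacher k w i x * rademacher k w j x \<partial>uniform_slab k w) = 0"
    if "1 \<le> i" "i < j" for i j
  proof -
    have bnd: "\<bar>rademacher k w i x * rademacher k w j x\<bar> \<le> 1" for x
      by (simp add: rademacher_def)
    have "(\<integral>x. indicator (slab k w) x * (rademacher k w i x * rademacher k w j x) \<partial>lborel) = 0"
      using w that(1)
      by (rule integral_antiperiodic_eq_0)
        (auto intro!: integrable_on_slab[OF w _ bnd]
          simp: rademacher_antiperiodic[OF w] rademacher_periodic[OF w that(2)])
    then show ?thesis using w by (subst integral_uniform_slab) auto
  qed
  show ?thesis
  proof
    fix j :: nat assume "j \<in> {1..M}"
    have bnd: "\<bar>rademacher k w j x\<bar> \<le> 1" for x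
      by (simp add: rademacher_def)
    have "(\<integral>x. indicator (slab k w) x * rademacher k w j x \<partial>lborel) = 0"
      using w \<open>j \<in> {1..M}\<close>
      by (intro integral_antiperiodic_eq_0[where j=j] integrable_on_slab[OF w _ bnd])
        (auto simp: rademacher_antiperiodic)
    then show "(\<integral>x. rademacher k w j x \<partial>uniform_slab k w) = 0"
      using w by (subst integral_uniform_slab) auto
  next
    fix i j :: nat assume "i \<in> {1..M}" "j \<in> {1..M}" "i \<noteq> j"
    then show "(\<integral>x. rademacher k w i x * rademacher k w j x \<partial>uniform_slab k w) = 0"
      using lt[of i j] lt[of j i] by (cases i j rule: linorder_cases) (auto simp: mult.commute)
  qed (use rademacher_cases in auto)
qed

section \<open>Perturbed uniform densities\<close>

text \<open>The value \<open>c = 1\<close> gives the functions to select from, which take only the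
  values 0 and \<open>L\<close>; \<open>c = \<gamma>\<close> gives the candidate true
  densities.\<close>

definition perturbation :: "'d::finite \<Rightarrow> real \<Rightarrow> real \<Rightarrow> nat \<Rightarrow> real ^ 'd \<Rightarrow> real" where
  "perturbation k L c j x = L / 2 * indicator (slab k (2 / L)) x * (1 + c * rademacher k (2 / L) j x)"

lemma perturbation_borel [measurable]: "perturbation k L c j \<in> borel_measurable borel"
  unfolding perturbation_def by measurable

lemma perturbation_bounds:
  assumes "L > 0" "0 \<le> c" "c \<le> 1"
  shows "0 \<le> perturbation k L c j x" "perturbation k L c j x \<le> L"
  using assms by (auto simp: perturbation_def rademacher_def indicator_def field_simps)

lemma Linf_norm_perturbation:
  assumes "L > 0" "0 \<le> c" "c \<le> 1"
  shows "Linf_norm (perturbation k L c j) \<le> ereal L"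
  unfolding Linf_norm_def
  using perturbation_bounds[OF assms, of k j] by (intro esssup_I) (auto intro!: AE_I2 simp: abs_of_nonneg)

lemma density_perturbation:
  assumes L: "L > 0" and c: "0 \<le> c" "c \<le> 1"
  shows "density lborel (\<lambda>x. ennreal (perturbation k L c j x))
    = density (uniform_slab k (2 / L)) (\<lambda>x. ennreal (1 + c * rademacher k (2 / L) j x))"
proof -
  have "0 \<le> 1 + c * rademacher k (2 / L) j x" for x
    using c by (simp add: rademacher_def)
  then show ?thesis
    unfolding uniform_slab_def using L
    by (subst density_density_eq) (auto simp: perturbation_def indicator_def ennreal_mult'[symmetric]
      intro!: arg_cong2[where f=density])
qed

lemma square_integrable_perturbation:
  assumes "L > 0" "0 \<le> c" "c \<le> 1"
  shows "perturbation k L c j \<in> square_integrable_functions"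
proof -
  have "integrable lborel (\<lambda>x. indicator (slab k (2 / L)) x * (perturbation k L c j x)\<^sup>2)"
    using assms perturbation_bounds[OF assms, of k j]
    by (intro integrable_on_slab[where B="L\<^sup>2"]) (auto intro!: power_mono)
  also have "(\<lambda>x. indicator (slab k (2 / L)) x * (perturbation k L c j x)\<^sup>2) = (\<lambda>x. (perturbation k L c j x)\<^sup>2)"
    by (auto simp: perturbation_def indicator_def)
  finally show ?thesis by (simp add: square_integrable_functions_def)
qed

lemma prob_space_perturbation:
  fixes k :: "'d::finite"
  assumes L: "L > 0" and c: "0 \<le> c" "c \<le> 1" and j: "j \<ge> 1"
  shows "prob_space (density (uniform_slab k (2 / L)) (\<lambda>x. ennreal (1 + c * rademacher k (2 / L) j x)))"
proof
  \<comment> \<open>Only the index \<open>j\<close> is involved, and this range contains it.\<close>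
  interpret orthogonal_signs "uniform_slab k (2 / L)" "rademacher k (2 / L)" "{1..j}"
    using L by (intro orthogonal_signs_rademacher) simp
  have nn: "0 \<le> 1 + c * rademacher k (2 / L) j x" for x
    using c by (simp add: rademacher_def)
  have "(\<integral>\<^sup>+x. ennreal (1 + c * rademacher k (2 / L) j x) \<partial>uniform_slab k (2 / L)) = 1"
    using integral_single[of j c] j nn by (subst nn_integral_eq_integral) auto
  then show "emeasure (density (uniform_slab k (2 / L)) (\<lambda>x. ennreal (1 + c * rademacher k (2 / L) j x)))
      (space (density (uniform_slab k (2 / L)) (\<lambda>x. ennreal (1 + c * rademacher k (2 / L) j x)))) = 1"
    by (subst emeasure_density) auto
qed

lemma perturbation_bounded_density:
  assumes L: "L > 0" and c: "0 \<le> c" "c \<le> 1" and j: "j \<ge> 1"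
  shows "perturbation k L c j \<in> bounded_densities L"
proof -
  interpret prob_space "density lborel (\<lambda>x. ennreal (perturbation k L c j x))"
    unfolding density_perturbation[OF L c] by (rule prob_space_perturbation[OF assms])
  have "(\<integral>\<^sup>+x. ennreal (perturbation k L c j x) \<partial>lborel) = 1"
    using emeasure_space_1 by (simp add: emeasure_density)
  then show ?thesis
    using perturbation_bounds[OF L c, of k j] Linf_norm_perturbation[OF L c, of k j]
    by (simp add: bounded_densities_def probability_densities_def)
qed

text \<open>The product is \<open>lr\<close> written out; this ties the sampling model to the
  testing bounds.\<close>

lemma sample_law_perturbation:
  fixes k :: "'d::finite"
  assumes L: "L > 0" and c: "0 \<le> c" "c \<le> 1" and j: "j \<ge> 1"
  shows "sample_law n (perturbation k L c j)
    = density (\<Pi>\<^sub>M i\<in>{1..n}. uniform_slab k (2 / L))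
        (\<lambda>X. ennreal (\<Prod>i\<in>{1..n}. 1 + c * rademacher k (2 / L) j (X i)))"
  unfolding sample_law_def density_perturbation[OF L c]
proof (rule PiM_density)
  show "prob_space (uniform_slab k (2 / L))"
    using L by (intro prob_space_uniform_slab) simp
  show "0 \<le> 1 + c * rademacher k (2 / L) j x" for x
    using c by (simp add: rademacher_def)
qed (use prob_space_perturbation[OF assms] in auto)

text \<open>On the slab the difference is \<open>L / 2\<close> times \<open>e i - c * e j\<close>,
  with \<open>e\<close> the Rademacher signs, so only their inner product matters. A wrong index
  costs \<open>L * c\<close> more than the right one.\<close>

lemma L2_norm_perturbation_diff:
  fixes k :: "'d::finite"
  assumes L: "L > 0" and i: "i \<ge> 1" and j: "j \<ge> 1"
  shows "(L2_norm (\<lambda>x. perturbation k L 1 i x - perturbation k L c j x))\<^sup>2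
    = L / 2 * (1 + c\<^sup>2 - (if i = j then 2 * c else 0))"
proof -
  interpret orthogonal_signs "uniform_slab k (2 / L)" "rademacher k (2 / L)" "{1..max i j}"
    using L by (intro orthogonal_signs_rademacher) simp
  let ?e = "rademacher k (2 / L)"
  \<comment> \<open>One factor \<open>L / 2\<close> is split off as the density of the uniform law
    on the slab.\<close>
  have sq: "(perturbation k L 1 i x - perturbation k L c j x)\<^sup>2
      = L / 2 * (L / 2 * (indicator (slab k (2 / L)) x * (1 + c\<^sup>2 - 2 * c * (?e i x * ?e j x))))" for x
    by (auto simp: perturbation_def indicator_def rademacher_def power2_eq_square algebra_simps)
  have "(L2_norm (\<lambda>x. perturbation k L 1 i x - perturbation k L c j x))\<^sup>2
      = (\<integral>x. (perturbation k L 1 i x - perturbation k L c j x)\<^sup>2 \<partial>lborel)"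
    unfolding L2_norm_def by (intro real_sqrt_pow2 Bochner_Integration.integral_nonneg) simp
  also have "\<dots> = L / 2 * (\<integral>x. 1 + c\<^sup>2 - 2 * c * (?e i x * ?e j x) \<partial>uniform_slab k (2 / L))"
    unfolding sq using L by (subst integral_uniform_slab) auto
  also have "(\<integral>x. 1 + c\<^sup>2 - 2 * c * (?e i x * ?e j x) \<partial>uniform_slab k (2 / L))
      = 1 + c\<^sup>2 - 2 * c * (\<integral>x. ?e i x * ?e j x \<partial>uniform_slab k (2 / L))"
    using integrable_sign_mult[of i j] by (simp add: prob_space[simplified])
  also have "(\<integral>x. ?e i x * ?e j x \<partial>uniform_slab k (2 / L)) = (if i = j then 1 else 0)"
    using orth[of i j] i j by (auto simp: square_sign prob_space[simplified])
  finally show ?thesis by auto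
qed

section \<open>From identification error to excess risk\<close>

theorem theorem2p1:
  fixes L x :: real and M n :: nat
  assumes "L > 0" and "M \<ge> 2" and "n \<ge> 1"
    and "x \<ge> 0"
    and "(ln (real M) + x) / real n < 3"
  shows "\<exists>fs :: nat \<Rightarrow> real ^ 'd \<Rightarrow> real.
    (\<forall>j\<in>{1..M}. fs j \<in> square_integrable_functions \<and> Linf_norm (fs j) \<le> ereal L) \<and>
    (INF S\<in>selectors n M fs. SUP f\<in>bounded_densities L.
       emeasure (sample_law n f)
         {X \<in> space (sample_law n f).
            excess_risk M fs f (S X) \<ge> L / sqrt 3 * sqrt ((x + ln (real M)) / real n)})
      \<ge> ennreal (1 / 24 * exp (- x))"
proof -
  \<comment> \<open>Any coordinate can carry the oscillation; one exists because types are
    nonempty.\<close>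
  obtain k :: 'd where True by blast
  \<comment> \<open>Calibrated so that the gap \<open>L * \<gamma>\<close> equals the threshold; the
    hypothesis with the bound 3 then says \<open>\<gamma>\<^sup>2 < 1\<close>.\<close>
  define \<gamma> where "\<gamma> = sqrt ((x + ln M) / n) / sqrt 3"
  have pos: "0 \<le> (x + ln M) / n" using assms by (intro divide_nonneg_nonneg add_nonneg_nonneg) auto
  have \<gamma>2: "\<gamma>\<^sup>2 = (x + ln M) / n / 3"
    using pos by (simp add: \<gamma>_def power_divide)
  have \<gamma>: "0 \<le> \<gamma>" "\<gamma> \<le> 1"
  proof -
    show "0 \<le> \<gamma>" using pos by (simp add: \<gamma>_def)
    have "\<gamma>\<^sup>2 \<le> 1\<^sup>2" unfolding \<gamma>2 using assms(5) by (simp add: add.commute)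
    then show "\<gamma> \<le> 1" by (rule power2_le_imp_le) simp
  qed
  have n\<gamma>: "n * \<gamma>\<^sup>2 = (x + ln (card {1..M})) / 3"
    using \<open>n \<ge> 1\<close> by (simp add: \<gamma>2)
  define fs where "fs = perturbation k L 1"
  define thr where "thr = L / sqrt 3 * sqrt ((x + ln M) / n)"
  have thr: "thr = L * \<gamma>" by (simp add: thr_def \<gamma>_def)
  let ?Q = "uniform_slab k (2 / L)"
  let ?P = "\<Pi>\<^sub>M i\<in>{1..n}. ?Q"
  interpret orthogonal_signs ?Q "rademacher k (2 / L)" "{1..M}"
    using \<open>L > 0\<close> by (intro orthogonal_signs_rademacher) simp
  have excess: "thr \<le> excess_risk M fs (perturbation k L \<gamma> j) (fs i)"
    if ij: "i \<in> {1..M}" "j \<in> {1..M}" "i \<noteq> j" for i j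
  proof -
    let ?r = "\<lambda>i. (L2_norm (\<lambda>x. fs i x - perturbation k L \<gamma> j x))\<^sup>2"
    have "(INF l\<in>{1..M}. ?r l) \<le> ?r j"
      using ij by (intro cINF_lower) auto
    moreover have "?r i - ?r j = L * \<gamma>"
      using ij \<open>L > 0\<close> by (simp add: fs_def L2_norm_perturbation_diff algebra_simps)
    ultimately show ?thesis unfolding excess_risk_def thr by linarith
  qed
  \<comment> \<open>The functions \<open>fs\<close> are already fixed; only the unfavourable
    density, through its index \<open>j\<close>, depends on the selector.\<close>
  have main: "ennreal (1 / 24 * exp (- x)) \<le> (SUP f\<in>bounded_densities L.
       emeasure (sample_law n f) {X \<in> space (sample_law n f). thr \<le> excess_risk M fs f (S X)})"
    if S: "S \<in> selectors n M fs" for S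
  proof -
    from S obtain J where S_eq: "S = (\<lambda>X. fs (J X))"
      and J: "J \<in> (\<Pi>\<^sub>M i\<in>{1..n}. borel) \<rightarrow>\<^sub>M count_space {1..M}"
      unfolding selectors_def by auto
    have sets_P: "sets ?P = sets (\<Pi>\<^sub>M i\<in>{1..n}. borel)"
      by (intro sets_PiM_cong) auto
    have JP: "J \<in> ?P \<rightarrow>\<^sub>M count_space {1..M}"
      using J measurable_cong_sets[OF sets_P refl] by blast
    obtain j where j: "j \<in> {1..M}"
      and ge: "exp (- x) / 24 \<le> (\<integral>X. lr \<gamma> n j X * indicator {X. J X \<noteq> j} X \<partial>?P)"
      using identification_error_ge[OF _ _ \<open>x \<ge> 0\<close> \<gamma> n\<gamma> JP] \<open>M \<ge> 2\<close> by auto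
    define f where "f = perturbation k L \<gamma> j"
    have law: "sample_law n f = density ?P (\<lambda>X. ennreal (lr \<gamma> n j X))"
      unfolding f_def lr_def using j \<open>L > 0\<close> \<gamma> by (intro sample_law_perturbation) auto
    have ev: "{X \<in> space ?P. R (J X)} \<in> sets ?P" for R
      using JP by (intro measurable_sets_Collect[of J]) auto
    have lr_meas: "lr \<gamma> n j \<in> borel_measurable ?P"
      using integral_lr(1)[OF j] by (rule borel_measurable_integrable)
    let ?A = "{X \<in> space ?P. J X \<noteq> j}"
    have "ennreal (1 / 24 * exp (- x)) \<le> ennreal (\<integral>X. lr \<gamma> n j X * indicator ?A X \<partial>?P)"
    proof (rule ennreal_leI)
      have "(\<integral>X. lr \<gamma> n j X * indicator {X. J X \<noteq> j} X \<partial>?P) = (\<integral>X. lr \<gamma> n j X * indicator ?A X \<partial>?P)"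
        by (intro Bochner_Integration.integral_cong) (auto simp: indicator_def)
      then show "1 / 24 * exp (- x) \<le> (\<integral>X. lr \<gamma> n j X * indicator ?A X \<partial>?P)"
        using ge by simp
    qed
    also have "\<dots> = (\<integral>\<^sup>+X. ennreal (lr \<gamma> n j X * indicator ?A X) \<partial>?P)"
      using integrable_mult_indicator[OF ev integral_lr(1)[OF j]] lr_nonneg[OF \<gamma>]
      by (intro nn_integral_eq_integral[symmetric]) (auto simp: mult.commute)
    also have "\<dots> = (\<integral>\<^sup>+X. ennreal (lr \<gamma> n j X) * indicator ?A X \<partial>?P)"
      by (intro nn_integral_cong) (auto simp: indicator_def)
    also have "\<dots> = emeasure (sample_law n f) ?A"
      unfolding law using lr_meas ev by (subst emeasure_density) auto
    also have "\<dots> \<le> emeasure (sample_law n f)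
        {X \<in> space (sample_law n f). thr \<le> excess_risk M fs f (S X)}"
    \<comment> \<open>Choosing any index other than \<open>j\<close> already forces the excess risk
      up to the threshold.\<close>
    proof (rule emeasure_mono)
      show "?A \<subseteq> {X \<in> space (sample_law n f). thr \<le> excess_risk M fs f (S X)}"
      proof
        fix X assume "X \<in> ?A"
        then have "J X \<in> {1..M}" "J X \<noteq> j" "X \<in> space ?P"
          using measurable_space[OF JP] by auto
        then show "X \<in> {X \<in> space (sample_law n f). thr \<le> excess_risk M fs f (S X)}"
          using excess[OF _ j] unfolding f_def[symmetric] by (simp add: S_eq law)
      qed
      show "{X \<in> space (sample_law n f). thr \<le> excess_risk M fs f (S X)} \<in> sets (sample_law n f)"
        unfolding law S_eq using ev[of "\<lambda>i. thr \<le> excess_risk M fs f (fs i)"] by simp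
    qed
    also have "\<dots> \<le> (SUP f\<in>bounded_densities L.
       emeasure (sample_law n f) {X \<in> space (sample_law n f). thr \<le> excess_risk M fs f (S X)})"
      unfolding f_def using j \<open>L > 0\<close> \<gamma> by (intro SUP_upper perturbation_bounded_density) auto
    finally show ?thesis .
  qed
  show ?thesis
    using main \<open>L > 0\<close>
    by (intro exI[of _ fs] conjI ballI INF_greatest)
      (auto simp: thr_def fs_def square_integrable_perturbation Linf_norm_perturbation)
qed

end
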